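(* Let $X \in \mathbb{R}^{m \times N}$ be a matrix of rank $r$. Suppose that oASIS, applied to $X$, returns a set of $r$ columns, indexed by $S \subset \{1,\dots,N\}$, before terminating with $\max_i \Delta(i) = 0$. Then exact matrix recovery of $X$ occurs, i.e. $X = X_S X_S^{+} X$.
   Context: For $S \subset \{1,\dots,N\}$, $X_S$ denotes the submatrix of columns of $X$ indexed by $S$, and $X_S^{+}$ denotes its pseudoinverse, so that $X_S X_S^{+} X$ is the orthogonal projection of the columns of $X$ onto the span of the columns of $X_S$. Exact matrix recovery from $S$ means $X = X_S X_S^{+} X$. oASIS (Accelerated Sequential Incoherence Selection) is the following greedy column selection procedure, operating on the Gram matrix $G = X^T X$. Let $x_i$ denote the $i$-th column of $X$. It is initialized with an index set $S$ for which the corresponding columns are linearly independent. At each step, given the current set $S$ of selected indices, put $W = X_S^T X_S$ (which is invertible), and for each unselected index $i \notin S$ put $b_i = X_S^T x_i$, $d_i = x_i^T x_i = G_{ii}$, and $$\Delta(i) = d_i - b_i^T W^{-1} b_i .$$ The procedure picks an index $i \notin S$ maximizing $|\Delta(i)|$. If this maximal value is $0$ (or, more generally, is below a user-set threshold $\delta \ge 0$), the procedure terminates; otherwise it replaces $S$ by $S \cup \{i\}$ and repeats, stopping also if a prescribed maximum number of columns has been selected. *)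

theory Defs
  imports
    "Jordan_Normal_Form.DL_Rank"
    "Jordan_Normal_Form.DL_Submatrix"
    "Jordan_Normal_Form.Gauss_Jordan_Elimination"
begin

text \<open>Columns are numbered from 0, so index sets are subsets of \<open>{..<N}\<close>.  The columns of
  a submatrix are listed in increasing order of their indices in \<open>X\<close>.\<close>

definition col_submat :: "real mat \<Rightarrow> nat set \<Rightarrow> real mat" where
  "col_submat X S = submatrix X UNIV S"

definition lin_indpt_cols :: "real mat \<Rightarrow> bool" where
  "lin_indpt_cols A \<longleftrightarrow> distinct (cols A) \<and>
     \<not> module.lin_dep class_ring (module_vec TYPE(real) (dim_row A)) (set (cols A))"

text \<open>The Moore--Penrose pseudoinverse, given by the four Penrose conditions.\<close>

definition is_pseudoinverse :: "real mat \<Rightarrow> real mat \<Rightarrow> bool" where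
  "is_pseudoinverse A B \<longleftrightarrow>
     B \<in> carrier_mat (dim_col A) (dim_row A) \<and>
     A * B * A = A \<and> B * A * B = B \<and>
     transpose_mat (A * B) = A * B \<and> transpose_mat (B * A) = B * A"

lemma is_pseudoinverse_unique:
  assumes B: "is_pseudoinverse A B" and C: "is_pseudoinverse A C"
  shows "B = C"
proof -
  obtain m n where A: "A \<in> carrier_mat m n" by blast
  have cB: "B \<in> carrier_mat n m" and cC: "C \<in> carrier_mat n m"
    using A B C unfolding is_pseudoinverse_def by auto
  note B = B[unfolded is_pseudoinverse_def] and C = C[unfolded is_pseudoinverse_def]
  have AB: "A * B \<in> carrier_mat m m" and AC: "A * C \<in> carrier_mat m m"
    and BA: "B * A \<in> carrier_mat n n" and CA: "C * A \<in> carrier_mat n n"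
    using A cB cC by auto
  have "A * B = A * C * (A * B)"
    using C assoc_mult_mat[OF AC A cB] by simp
  also have "\<dots> = transpose_mat (A * C) * transpose_mat (A * B)"
    using B C by simp
  also have "\<dots> = transpose_mat (A * B * (A * C))"
    using transpose_mult[OF AB AC] by simp
  also have "A * B * (A * C) = A * C"
    using B assoc_mult_mat[OF AB A cC] by simp
  finally have 1: "A * B = A * C" using C by simp
  have "B * A = B * A * (C * A)"
    using C assoc_mult_mat[OF cB A CA] assoc_mult_mat[OF A cC A] by simp
  also have "\<dots> = transpose_mat (B * A) * transpose_mat (C * A)"
    using B C by simp
  also have "\<dots> = transpose_mat (C * A * (B * A))"
    using transpose_mult[OF CA BA] by simp
  also have "C * A * (B * A) = C * A"
    using B assoc_mult_mat[OF cC A BA] assoc_mult_mat[OF A cB A] by simp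
  finally have 2: "B * A = C * A" using C by simp
  have "B = B * A * B" using B by simp
  also have "\<dots> = C * (A * B)" using 2 assoc_mult_mat[OF cC A cB] by simp
  also have "\<dots> = C * A * C" using 1 assoc_mult_mat[OF cC A cC] by simp
  finally show ?thesis using C by simp
qed

definition pseudoinverse :: "real mat \<Rightarrow> real mat" where
  "pseudoinverse A = (THE B. is_pseudoinverse A B)"

definition exact_recovery :: "real mat \<Rightarrow> nat set \<Rightarrow> bool" where
  "exact_recovery X S \<longleftrightarrow>
     X = col_submat X S * pseudoinverse (col_submat X S) * X"

text \<open>The quantity \<open>d\<^sub>i - b\<^sub>i\<^sup>T W\<^sup>-\<^sup>1 b\<^sub>i\<close>.  The value of \<open>mat_inverse\<close> is an option; it is not
  \<open>None\<close> for the sets \<open>S\<close> below, whose columns are linearly independent.\<close>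

definition oasis_Delta :: "real mat \<Rightarrow> nat set \<Rightarrow> nat \<Rightarrow> real" where
  "oasis_Delta X S i =
     (let XS = col_submat X S;
          W = transpose_mat XS * XS;
          b = transpose_mat XS *\<^sub>v col X i;
          d = col X i \<bullet> col X i
      in d - b \<bullet> (the (mat_inverse W) *\<^sub>v b))"

definition unselected :: "real mat \<Rightarrow> nat set \<Rightarrow> nat set" where
  "unselected X S = {..<dim_col X} - S"

text \<open>\<open>\<delta>\<close> is the threshold and \<open>l\<close> the maximum number of columns; \<open>l \<ge> dim_col X\<close> imposes
  no restriction.\<close>

definition oasis_stops :: "real mat \<Rightarrow> real \<Rightarrow> nat \<Rightarrow> nat set \<Rightarrow> bool" where
  "oasis_stops X \<delta> l S \<longleftrightarrow>
     l \<le> card S \<or> unselected X S = {} \<or>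
     (let M = Max ((\<lambda>i. \<bar>oasis_Delta X S i\<bar>) ` unselected X S) in M = 0 \<or> M < \<delta>)"

text \<open>Ties in the greedy choice may be broken arbitrarily, so a run from \<open>S0\<close> is described by
  the index sets it can reach.\<close>

inductive oasis_reaches :: "real mat \<Rightarrow> real \<Rightarrow> nat \<Rightarrow> nat set \<Rightarrow> nat set \<Rightarrow> bool"
  for X \<delta> l S0 where
  init: "oasis_reaches X \<delta> l S0 S0"
| step: "oasis_reaches X \<delta> l S0 S \<Longrightarrow> \<not> oasis_stops X \<delta> l S \<Longrightarrow>
    is_arg_max (\<lambda>j. \<bar>oasis_Delta X S j\<bar>) (\<lambda>j. j \<in> unselected X S) i \<Longrightarrow>
    oasis_reaches X \<delta> l S0 (insert i S)"

definition oasis_returns :: "real mat \<Rightarrow> real \<Rightarrow> nat \<Rightarrow> nat set \<Rightarrow> nat set \<Rightarrow> bool" where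
  "oasis_returns X \<delta> l S0 S \<longleftrightarrow>
     S0 \<subseteq> {..<dim_col X} \<and> lin_indpt_cols (col_submat X S0) \<and>
     oasis_reaches X \<delta> l S0 S \<and> oasis_stops X \<delta> l S"

end

theory Submission
  imports Defs
begin

text \<open>If \<open>x\<^sub>i = X\<^sub>S w\<close> then \<open>b\<^sub>i = W w\<close>, so \<open>\<Delta>(i) = 0\<close>; hence oASIS only ever selects a column
  outside the span of the previous ones, and \<open>X\<^sub>S\<close> keeps independent columns.  When \<open>|S|\<close> equals
  the rank, these columns span the column space of \<open>X\<close>, so every \<open>x\<^sub>j\<close> has the form \<open>X\<^sub>S w\<close> and is
  fixed by \<open>X\<^sub>S X\<^sub>S\<^sup>+\<close> because \<open>X\<^sub>S X\<^sub>S\<^sup>+ X\<^sub>S = X\<^sub>S\<close>.\<close>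

section \<open>Independence of columns as injectivity\<close>

text \<open>Encodes independence through coefficient vectors, so that neither
  \<open>distinct\<close> nor a span inside \<open>module_vec\<close> has to be carried through the
  induction over a run.\<close>

definition trivial_kernel :: "real mat \<Rightarrow> bool" where
  "trivial_kernel A \<longleftrightarrow>
     (\<forall>v \<in> carrier_vec (dim_col A). A *\<^sub>v v = 0\<^sub>v (dim_row A) \<longrightarrow> v = 0\<^sub>v (dim_col A))"

lemma mult_unit_vec:
  fixes A :: "'a :: semiring_1 mat"
  assumes "j < dim_col A"
  shows "A *\<^sub>v unit_vec (dim_col A) j = col A j"
  using assms by (intro eq_vecI) auto

text \<open>A repeated column yields the nonzero kernel vector
  \<open>unit_vec n i - unit_vec n j\<close> with \<open>n = dim_col A\<close>, so a trivial kernel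
  forces \<open>distinct (cols A)\<close>. For distinct columns, linear dependences and nonzero
  kernel vectors correspond.\<close>

lemma trivial_kernel_iff_lin_indpt_cols: "trivial_kernel A \<longleftrightarrow> lin_indpt_cols A"
proof -
  interpret vec_space "TYPE(real)" "dim_row A" .
  have A: "A \<in> carrier_mat (dim_row A) (dim_col A)" by simp
  show ?thesis
  proof
    assume tk: "trivial_kernel A"
    have d: "distinct (cols A)"
    proof (rule ccontr)
      assume "\<not> distinct (cols A)"
      then obtain i j where ij: "i < dim_col A" "j < dim_col A" "i \<noteq> j" "col A i = col A j"
        by (auto simp: distinct_conv_nth)
      let ?v = "unit_vec (dim_col A) i - unit_vec (dim_col A) j :: real vec"
      have "A *\<^sub>v ?v = A *\<^sub>v unit_vec (dim_col A) i - A *\<^sub>v unit_vec (dim_col A) j"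
        by (rule mult_minus_distrib_mat_vec[OF A]) auto
      also have "\<dots> = 0\<^sub>v (dim_row A)"
        using ij by (simp add: mult_unit_vec)
      finally have "?v = 0\<^sub>v (dim_col A)" using tk by (simp add: trivial_kernel_def)
      then have "?v $ i = 0" using ij by simp
      then show False using ij by simp
    qed
    then show "lin_indpt_cols A"
      using tk lin_depE[OF A _ d] unfolding lin_indpt_cols_def trivial_kernel_def by blast
  next
    assume "lin_indpt_cols A"
    then show "trivial_kernel A"
      using lin_depI[OF A] unfolding lin_indpt_cols_def trivial_kernel_def by blast
  qed
qed

section \<open>Submatrices in terms of the original column indices\<close>

context
  fixes X :: "real mat" and S :: "nat set"
  assumes S: "S \<subseteq> {..<dim_col X}"
begin

lemma dim_col_submat: "dim_row (col_submat X S) = dim_row X" "dim_col (col_submat X S) = card S"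
proof -
  have "{j. j < dim_col X \<and> j \<in> S} = S" using S by auto
  then show "dim_row (col_submat X S) = dim_row X" "dim_col (col_submat X S) = card S"
    by (simp_all add: col_submat_def dim_submatrix)
qed

lemma col_submat_carrier: "col_submat X S \<in> carrier_mat (dim_row X) (card S)"
  using dim_col_submat by auto

lemma finite_selected: "finite S"
  using S finite_subset by blast

text \<open>\<open>pick S\<close> is strictly increasing on the positions, hence injective, and its
  image is a subset of \<open>S\<close> with \<open>card S\<close> elements.\<close>

lemma bij_betw_pick: "bij_betw (pick S) {..<card S} S"
proof -
  have "inj_on (pick S) {..<card S}"
    by (rule linorder_inj_onI') (auto dest: pick_mono_le)
  moreover have "pick S ` {..<card S} \<subseteq> S"
    by (auto intro: pick_in_set_le)
  ultimately show ?thesis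
    using finite_selected card_subset_eq[of S "pick S ` {..<card S}"]
    by (simp add: bij_betw_def card_image)
qed

text \<open>Moves coefficients from positions in the submatrix to indices in \<open>X\<close>.
  Inserting an index into \<open>S\<close> shifts positions, but in the sum over \<open>S\<close> it
  only adds one summand.\<close>

lemma col_submat_mult_vec:
  "col_submat X S *\<^sub>v vec (card S) (\<lambda>k. c (pick S k)) =
   vec (dim_row X) (\<lambda>i. \<Sum>j\<in>S. X $$ (i, j) * c j)"
proof (rule eq_vecI)
  fix i assume "i < dim_vec (vec (dim_row X) (\<lambda>i. \<Sum>j\<in>S. X $$ (i, j) * c j))"
  then have i: "i < dim_row X" by simp
  have "{j. j < dim_col X \<and> j \<in> S} = S" using S by auto
  then have ent: "col_submat X S $$ (i, k) = X $$ (i, pick S k)" if "k < card S" for k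
    using that i by (simp add: col_submat_def submatrix_index pick_UNIV)
  have "(col_submat X S *\<^sub>v vec (card S) (\<lambda>k. c (pick S k))) $ i =
        (\<Sum>k<card S. X $$ (i, pick S k) * c (pick S k))"
    using i by (simp add: dim_col_submat scalar_prod_def ent atLeast0LessThan)
  also have "\<dots> = (\<Sum>j\<in>S. X $$ (i, j) * c j)"
    by (rule sum.reindex_bij_betw[OF bij_betw_pick])
  finally show "(col_submat X S *\<^sub>v vec (card S) (\<lambda>k. c (pick S k))) $ i =
      vec (dim_row X) (\<lambda>i. \<Sum>j\<in>S. X $$ (i, j) * c j) $ i" using i by simp
qed (simp add: dim_col_submat)

lemma trivial_kernel_col_submat_iff:
  "trivial_kernel (col_submat X S) \<longleftrightarrow>
     (\<forall>c. (\<forall>i<dim_row X. (\<Sum>j\<in>S. X $$ (i, j) * c j) = 0) \<longrightarrow> (\<forall>j\<in>S. c j = 0))"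
proof safe
  fix c j
  assume tk: "trivial_kernel (col_submat X S)" and j: "j \<in> S"
    and z: "\<forall>i<dim_row X. (\<Sum>j\<in>S. X $$ (i, j) * c j) = 0"
  let ?v = "vec (card S) (\<lambda>k. c (pick S k))"
  have "col_submat X S *\<^sub>v ?v = 0\<^sub>v (dim_row X)"
    unfolding col_submat_mult_vec using z by auto
  then have v: "?v = 0\<^sub>v (card S)"
    using tk by (simp add: trivial_kernel_def dim_col_submat)
  obtain k where k: "k < card S" "j = pick S k"
    using bij_betw_pick j by (auto simp: bij_betw_def)
  then have "c j = ?v $ k" by simp
  also have "\<dots> = 0" using k by (simp add: v)
  finally show "c j = 0" .
next
  assume ind: "\<forall>c. (\<forall>i<dim_row X. (\<Sum>j\<in>S. X $$ (i, j) * c j) = 0) \<longrightarrow> (\<forall>j\<in>S. c j = 0)"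
  show "trivial_kernel (col_submat X S)"
    unfolding trivial_kernel_def dim_col_submat
  proof safe
    fix v assume v: "v \<in> carrier_vec (card S)" and z: "col_submat X S *\<^sub>v v = 0\<^sub>v (dim_row X)"
    \<comment> \<open>The number of elements of \<open>S\<close> below \<open>j\<close> is the
      position of \<open>j\<close> in the increasing listing of \<open>S\<close>, so on
      \<open>S\<close> this map inverts \<open>pick S\<close>.\<close>
    define c where "c j = v $ (card {a \<in> S. a < j})" for j
    have ck: "c (pick S k) = v $ k" if "k < card S" for k
      using that by (simp add: c_def card_pick_le)
    then have veq: "v = vec (card S) (\<lambda>k. c (pick S k))" using v by auto
    have "vec (dim_row X) (\<lambda>i. \<Sum>j\<in>S. X $$ (i, j) * c j) = 0\<^sub>v (dim_row X)"
      using z veq col_submat_mult_vec by metis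
    then have "\<forall>i<dim_row X. (\<Sum>j\<in>S. X $$ (i, j) * c j) = 0"
      by (auto dest!: arg_cong[where f = "\<lambda>v. v $ _"] simp: vec_eq_iff)
    then have "\<forall>j\<in>S. c j = 0" using ind by blast
    then show "v = 0\<^sub>v (card S)"
      using v by (intro eq_vecI) (auto simp: pick_in_set_le simp flip: ck)
  qed
qed

lemma selected_col_in_range:
  assumes "j \<in> S"
  obtains w where "w \<in> carrier_vec (card S)" "col X j = col_submat X S *\<^sub>v w"
proof
  let ?c = "\<lambda>k. if k = j then 1 else 0 :: real"
  show "vec (card S) (\<lambda>k. ?c (pick S k)) \<in> carrier_vec (card S)" by simp
  show "col X j = col_submat X S *\<^sub>v vec (card S) (\<lambda>k. ?c (pick S k))"
    unfolding col_submat_mult_vec[of ?c]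
    using assms S finite_selected by (intro eq_vecI) (auto simp: if_distrib cong: if_cong)
qed

end

text \<open>In a vanishing combination of the columns in \<open>insert j S\<close>, a nonzero
  coefficient of \<open>j\<close> can be divided out, which expresses column \<open>j\<close>
  through \<open>S\<close>. If that coefficient is zero, independence of \<open>S\<close> kills the
  others.\<close>

lemma trivial_kernel_insert_or_in_range:
  assumes S: "S \<subseteq> {..<dim_col X}"
    and tk: "trivial_kernel (col_submat X S)"
    and j: "j < dim_col X" "j \<notin> S"
  shows "trivial_kernel (col_submat X (insert j S)) \<or>
    (\<exists>w \<in> carrier_vec (card S). col X j = col_submat X S *\<^sub>v w)"
proof (rule disjCI)
  assume notin: "\<not> (\<exists>w \<in> carrier_vec (card S). col X j = col_submat X S *\<^sub>v w)"
  have S': "insert j S \<subseteq> {..<dim_col X}" using S j by auto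
  have "\<forall>k\<in>insert j S. c k = 0"
    if "\<forall>i<dim_row X. (\<Sum>k\<in>insert j S. X $$ (i, k) * c k) = 0" for c
  proof -
    have z: "X $$ (i, j) * c j + (\<Sum>k\<in>S. X $$ (i, k) * c k) = 0" if "i < dim_row X" for i
      using that \<open>\<forall>i<dim_row X. (\<Sum>k\<in>insert j S. X $$ (i, k) * c k) = 0\<close> finite_selected[OF S] j(2)
      by simp
    have "c j = 0"
    proof (rule ccontr)
      assume cj: "c j \<noteq> 0"
      let ?w = "vec (card S) (\<lambda>k. - c (pick S k) / c j)"
      have "col X j = col_submat X S *\<^sub>v ?w"
        unfolding col_submat_mult_vec[OF S, of "\<lambda>k. - c k / c j"]
      proof (rule eq_vecI)
        fix i assume "i < dim_vec (vec (dim_row X) (\<lambda>i. \<Sum>k\<in>S. X $$ (i, k) * (- c k / c j)))"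
        then have i: "i < dim_row X" by simp
        have "(\<Sum>k\<in>S. X $$ (i, k) * (- c k / c j)) = - (\<Sum>k\<in>S. X $$ (i, k) * c k) / c j"
          by (simp add: sum_divide_distrib sum_negf)
        also have "\<dots> = X $$ (i, j)"
          using z[OF i] cj by (simp add: field_simps)
        finally show "col X j $ i = vec (dim_row X) (\<lambda>i. \<Sum>k\<in>S. X $$ (i, k) * (- c k / c j)) $ i"
          using i j by simp
      qed simp
      then show False using notin by (metis vec_carrier)
    qed
    then show ?thesis
      using tk[unfolded trivial_kernel_col_submat_iff[OF S]] z by auto
  qed
  then show "trivial_kernel (col_submat X (insert j S))"
    unfolding trivial_kernel_col_submat_iff[OF S'] by blast
qed

section \<open>Gram matrix and pseudoinverse\<close>

text \<open>If W = A^T A and W v = 0, then |A v|^2 = v^T W v = 0, so A v = 0 and v = 0. Hence det W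
  is nonzero, and \<open>the\<close> in \<open>oasis_Delta\<close> is applied to a genuine
  inverse.\<close>

lemma gram_inverse:
  assumes A: "A \<in> carrier_mat m n" and tk: "trivial_kernel A"
  obtains V where "mat_inverse (transpose_mat A * A) = Some V" "V \<in> carrier_mat n n"
    "V * (transpose_mat A * A) = 1\<^sub>m n" "(transpose_mat A * A) * V = 1\<^sub>m n"
proof -
  let ?W = "transpose_mat A * A"
  have W: "?W \<in> carrier_mat n n" and At: "transpose_mat A \<in> carrier_mat n m" using A by auto
  have "det ?W \<noteq> 0"
  proof
    assume "det ?W = 0"
    then obtain v where v: "v \<in> carrier_vec n" "v \<noteq> 0\<^sub>v n" "?W *\<^sub>v v = 0\<^sub>v n"
      using det_0_iff_vec_prod_zero_field[OF W] by auto
    have Av: "A *\<^sub>v v \<in> carrier_vec m" using A v by auto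
    have "(A *\<^sub>v v) \<bullet> (A *\<^sub>v v) = (transpose_mat A *\<^sub>v (A *\<^sub>v v)) \<bullet> v"
      using transpose_vec_mult_scalar[OF A v(1) Av] by simp
    also have "transpose_mat A *\<^sub>v (A *\<^sub>v v) = 0\<^sub>v n"
      using v assoc_mult_mat_vec[OF At A v(1)] by simp
    finally have "(A *\<^sub>v v) \<bullet> (A *\<^sub>v v) = 0" using v by simp
    then have "A *\<^sub>v v = 0\<^sub>v m" using conjugate_square_eq_0_vec[OF Av] by simp
    then show False using tk A v by (auto simp: trivial_kernel_def)
  qed
  then have "?W \<in> Units (ring_mat TYPE(real) n ())" by (rule det_non_zero_imp_unit[OF W])
  then obtain V where "mat_inverse ?W = Some V"
    using mat_inverse(1)[OF W, where b = "()"] by (cases "mat_inverse ?W") auto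
  with mat_inverse(2)[OF W this] show thesis using that by blast
qed

text \<open>For independent columns (A^T A)^{-1} A^T is an explicit left inverse satisfying the four
  Penrose conditions. Uniqueness then resolves the \<open>THE\<close> in
  \<open>pseudoinverse\<close>.\<close>

lemma pseudoinverse_trivial_kernel:
  assumes A: "A \<in> carrier_mat m n" and tk: "trivial_kernel A"
  shows "is_pseudoinverse A (pseudoinverse A)"
proof -
  obtain V where V: "V \<in> carrier_mat n n"
    "V * (transpose_mat A * A) = 1\<^sub>m n" "(transpose_mat A * A) * V = 1\<^sub>m n"
    using gram_inverse[OF A tk] by metis
  have At: "transpose_mat A \<in> carrier_mat n m" and W: "transpose_mat A * A \<in> carrier_mat n n"
    using A by auto
  have Vt: "transpose_mat V \<in> carrier_mat n n" using V by auto
  have Wt: "transpose_mat (transpose_mat A * A) = transpose_mat A * A"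
    using transpose_mult[OF At A] by simp
  \<comment> \<open>The Gram matrix is symmetric, so the transpose of \<open>V\<close> is again a
    left inverse of it and must equal \<open>V\<close>. This makes A V A^T symmetric, as the third
    Penrose condition asks.\<close>
  have "transpose_mat V * (transpose_mat A * A) = 1\<^sub>m n"
    using transpose_mult[OF W V(1)] V(3) Wt by simp
  then have "transpose_mat V = transpose_mat V * (transpose_mat A * A) * V"
    using assoc_mult_mat[OF Vt W V(1)] V(3) Vt by simp
  then have sym: "transpose_mat V = V"
    using \<open>transpose_mat V * (transpose_mat A * A) = 1\<^sub>m n\<close> V(1) by simp
  let ?B = "V * transpose_mat A"
  have B: "?B \<in> carrier_mat n m" using V At by auto
  have BA: "?B * A = 1\<^sub>m n" using assoc_mult_mat[OF V(1) At A] V by simp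
  have "A * ?B * A = A"
    using assoc_mult_mat[OF A B A] BA A by simp
  moreover have "?B * A * ?B = ?B" using BA left_mult_one_mat[OF B] by metis
  moreover have "transpose_mat (A * ?B) = A * ?B"
    using transpose_mult[OF A B] transpose_mult[OF V(1) At] sym assoc_mult_mat[OF A V(1) At]
    by (simp only: transpose_transpose)
  moreover have "transpose_mat (?B * A) = ?B * A"
    unfolding BA by simp
  moreover have "?B \<in> carrier_mat (dim_col A) (dim_row A)" using A B by auto
  ultimately have P: "is_pseudoinverse A ?B"
    unfolding is_pseudoinverse_def by blast
  show ?thesis
    unfolding pseudoinverse_def using P is_pseudoinverse_unique by (metis theI)
qed

section \<open>Independence along a run\<close>

text \<open>Applying the inverse Gram matrix to b = W w returns w, and b^T w = (A w)^T (A w) = d, so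
  both terms cancel.\<close>

lemma oasis_Delta_eq_0_if_in_range:
  assumes S: "S \<subseteq> {..<dim_col X}" and tk: "trivial_kernel (col_submat X S)"
    and w: "w \<in> carrier_vec (card S)" "col X i = col_submat X S *\<^sub>v w"
  shows "oasis_Delta X S i = 0"
proof -
  define A where "A = col_submat X S"
  have A: "A \<in> carrier_mat (dim_row X) (card S)" using col_submat_carrier[OF S] by (simp add: A_def)
  obtain V where V: "mat_inverse (transpose_mat A * A) = Some V" "V \<in> carrier_mat (card S) (card S)"
    "V * (transpose_mat A * A) = 1\<^sub>m (card S)"
    using gram_inverse[OF A] tk by (metis A_def)
  have At: "transpose_mat A \<in> carrier_mat (card S) (dim_row X)"
    and W: "transpose_mat A * A \<in> carrier_mat (card S) (card S)" using A by auto
  have x: "col X i = A *\<^sub>v w" using w by (simp add: A_def)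
  have Aw: "A *\<^sub>v w \<in> carrier_vec (dim_row X)" using A w by auto
  have b: "transpose_mat A *\<^sub>v (A *\<^sub>v w) = (transpose_mat A * A) *\<^sub>v w"
    using assoc_mult_mat_vec[OF At A w(1)] by simp
  have "V *\<^sub>v (transpose_mat A *\<^sub>v (A *\<^sub>v w)) = w"
    unfolding b using assoc_mult_mat_vec[OF V(2) W w(1)] V(3) w(1) by simp
  then show ?thesis
    using transpose_vec_mult_scalar[OF A w(1) Aw]
    by (simp add: oasis_Delta_def Let_def x V(1) flip: A_def)
qed

lemma oasis_reaches_independent:
  assumes "oasis_reaches X \<delta> l S0 S"
    and "S0 \<subseteq> {..<dim_col X}" "trivial_kernel (col_submat X S0)"
  shows "S \<subseteq> {..<dim_col X} \<and> trivial_kernel (col_submat X S)"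
  using assms
proof (induction rule: oasis_reaches.induct)
  case (step S i)
  then have S: "S \<subseteq> {..<dim_col X}" and tk: "trivial_kernel (col_submat X S)" by auto
  let ?D = "\<lambda>j. \<bar>oasis_Delta X S j\<bar>"
  have i: "i \<in> unselected X S" "\<And>j. j \<in> unselected X S \<Longrightarrow> ?D j \<le> ?D i"
    using step.hyps(3) by (auto simp: is_arg_max_def not_less)
  \<comment> \<open>The greedy choice attains the maximum that the stopping test inspects. As the
    run continues, this maximum is nonzero, so column \<open>i\<close> lies outside the range of the
    selected ones.\<close>
  have "Max (?D ` unselected X S) = ?D i"
    using i by (intro Max_eqI) (auto simp: unselected_def)
  then have "oasis_Delta X S i \<noteq> 0"
    using step.hyps(2) by (auto simp: oasis_stops_def Let_def)
  then show ?case
    using trivial_kernel_insert_or_in_range[OF S tk] oasis_Delta_eq_0_if_in_range[OF S tk] i(1) S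
    by (auto simp: unselected_def)
qed auto

section \<open>Rank bound and recovery\<close>

text \<open>The selected columns form an independent subset of the columns of \<open>X\<close>, and
  the rank bounds the size of any such subset. Distinctness makes that size equal to
  \<open>card S\<close>.\<close>

lemma card_le_rank_if_trivial_kernel:
  assumes X: "X \<in> carrier_mat m N" and S: "S \<subseteq> {..<N}" and tk: "trivial_kernel (col_submat X S)"
  shows "card S \<le> vec_space.rank m X"
proof -
  interpret vec_space "TYPE(real)" m .
  let ?A = "col_submat X S"
  have S': "S \<subseteq> {..<dim_col X}" using S X by simp
  have dA: "dim_row ?A = m" "dim_col ?A = card S" using dim_col_submat[OF S'] X by auto
  have li: "distinct (cols ?A)" "lin_indpt (set (cols ?A))"
    using tk dA by (auto simp: trivial_kernel_iff_lin_indpt_cols lin_indpt_cols_def)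
  have "set (cols ?A) \<subseteq> set (cols X)"
  proof
    fix x assume "x \<in> set (cols ?A)"
    then obtain k where k: "k < card S" "x = col ?A k" using dA by (auto simp: cols_def)
    have "{j. j < dim_col X \<and> j \<in> S} = S" using S' by auto
    then have "x = col X (pick S k)"
      using k X dA pick_in_set_le[OF k(1)] S
      by (intro eq_vecI) (auto simp: col_submat_def submatrix_index pick_UNIV)
    moreover have "pick S k < dim_col X" using pick_in_set_le[OF k(1)] S' by auto
    ultimately show "x \<in> set (cols X)" by (auto simp: cols_def)
  qed
  then have "card (set (cols ?A)) \<le> rank X" using rank_ge_card_indpt[OF X] li by blast
  then show ?thesis using distinct_card[OF li(1)] dA by simp
qed

theorem theorem2:
  fixes X :: "real mat" and m N r l :: nat and \<delta> :: real and S0 S :: "nat set"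
  assumes "X \<in> carrier_mat m N"
    and "vec_space.rank m X = r"
    and "\<delta> \<ge> 0"
    and "oasis_returns X \<delta> l S0 S"
    and "card S = r"
  shows "exact_recovery X S"
proof -
  note X = assms(1)
  have S: "S \<subseteq> {..<dim_col X}" and tk: "trivial_kernel (col_submat X S)"
    using oasis_reaches_independent[of X \<delta> l S0 S] assms(4)
    by (auto simp: oasis_returns_def trivial_kernel_iff_lin_indpt_cols)
  define A B where "A = col_submat X S" and "B = pseudoinverse A"
  have A: "A \<in> carrier_mat m r" using col_submat_carrier[OF S] X assms(5) by (simp add: A_def)
  have "is_pseudoinverse A B"
    using pseudoinverse_trivial_kernel[OF A] tk by (simp add: A_def B_def)
  then have B: "B \<in> carrier_mat r m" and ABA: "A * B * A = A"
    using A by (auto simp: is_pseudoinverse_def)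
  have range: "\<exists>w \<in> carrier_vec (card S). col X j = A *\<^sub>v w" if j: "j < N" for j
  proof (cases "j \<in> S")
    case True
    then show ?thesis using selected_col_in_range[OF S True] by (metis A_def)
  next
    case False
    \<comment> \<open>Adding \<open>j\<close> would give r + 1 independent columns in a matrix of
      rank r. So the other alternative of \<open>trivial_kernel_insert_or_in_range\<close> must
      hold.\<close>
    have "\<not> trivial_kernel (col_submat X (insert j S))"
    proof
      assume "trivial_kernel (col_submat X (insert j S))"
      then have "card (insert j S) \<le> r"
        using card_le_rank_if_trivial_kernel[OF X, of "insert j S"] S X j assms(2) by auto
      then show False using False finite_selected[OF S] assms(5) by simp
    qed
    then show ?thesis
      using trivial_kernel_insert_or_in_range[OF S tk _ False] j X by (auto simp: A_def)
  qed
  have AB: "A * B \<in> carrier_mat m m" using A B by auto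
  have "X = A * B * X"
  proof (rule mat_col_eqI)
    fix j assume "j < dim_col (A * B * X)"
    then have j: "j < N" using X by simp
    obtain w where w: "w \<in> carrier_vec r" "col X j = A *\<^sub>v w" using range[OF j] assms(5) by auto
    have "col (A * B * X) j = A * B *\<^sub>v (A *\<^sub>v w)"
      using col_mult2[OF AB X j] w by simp
    also have "\<dots> = col X j"
      using assoc_mult_mat_vec[OF AB A w(1)] ABA w(2) by simp
    finally show "col X j = col (A * B * X) j" by simp
  qed (use A X in auto)
  then show ?thesis by (simp add: exact_recovery_def A_def B_def)
qed

end
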